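(* Let $\mathbb{E}$ be a real Banach space continuously embedded into a Hilbert space $\mathbb{H}$, and let $\varphi^{t}\colon\mathbb{E}\to\mathbb{E}$, $t\ge 0$, be a semiflow on $\mathbb{E}$. Assume: (i) there are a symmetric bounded linear operator $P\in\mathcal{L}(\mathbb{E};\mathbb{E}^{*})$ and a splitting $\mathbb{E}=\mathbb{E}^{+}\oplus\mathbb{E}^{-}$ into a direct sum of subspaces such that $P$ is positive on $\mathbb{E}^{+}$ and negative on $\mathbb{E}^{-}$; (ii) $\dim\mathbb{E}^{-}=2$; (iii) for $V(v):=\langle v,Pv\rangle$ there are numbers $\delta>0$, $\tau_{V}\ge 0$, $\nu>0$ such that $$e^{2\nu r}V(\varphi^{r}(v_{1})-\varphi^{r}(v_{2}))-e^{2\nu l}V(\varphi^{l}(v_{1})-\varphi^{l}(v_{2}))\le-\delta\int_{l}^{r}e^{2\nu s}|\varphi^{s}(v_{1})-\varphi^{s}(v_{2})|_{\mathbb{H}}^{2}\,ds$$ for every $v_{1},v_{2}\in\mathbb{E}$ and all $0\le l\le r$ with $r-l\ge\tau_{V}$; (iv) there is $\tau_{com}>0$ such that the map $\varphi^{\tau_{com}}\colon\mathbb{E}\to\mathbb{E}$ is compact; (v) there are $\tau_{S}\ge 0$ and $C_{S}>0$ such that $\|\varphi^{\tau_{S}}(v_{1})-\varphi^{\tau_{S}}(v_{2})\|_{\mathbb{E}}\le C_{S}|v_{1}-v_{2}|_{\mathbb{H}}$ for all $v_{1},v_{2}\in\mathbb{E}$. Let $w_{0}\in\mathbb{E}$ have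 bounded positive semi-orbit and suppose that $\omega(w_{0})$ contains a terminal point $v_{0}$. Then $\omega(w_{0})=\{v_{0}\}$.
   Context: A semiflow on $\mathbb{E}$ is a family of maps $\varphi^{t}\colon\mathbb{E}\to\mathbb{E}$, $t\ge0$, with $\varphi^{0}=\mathrm{id}$, $\varphi^{t+s}=\varphi^{t}\circ\varphi^{s}$ for $t,s\ge 0$, and $(t,v)\mapsto\varphi^{t}(v)$ continuous on $[0,\infty)\times\mathbb{E}$. The norms in $\mathbb{E}$ and $\mathbb{H}$ are $\|\cdot\|_{\mathbb{E}}$ and $|\cdot|_{\mathbb{H}}$; elements of $\mathbb{E}$ are identified with their images in $\mathbb{H}$. $\langle v,f\rangle:=f(v)$ is the pairing of $v\in\mathbb{E}$, $f\in\mathbb{E}^{*}$. $P$ is symmetric if $\langle v,Pw\rangle=\langle w,Pv\rangle$ for all $v,w\in\mathbb{E}$; $P$ is positive (negative) on a subspace $\mathbb{L}$ if $\langle v,Pv\rangle>0$ (resp. $<0$) for all non-zero $v\in\mathbb{L}$. A map is compact if it sends bounded sets to relatively compact sets. The positive semi-orbit of $v_{0}$ is $\bigcup_{t\ge0}\varphi^{t}(v_{0})$ and $\omega(v_{0})=\bigcap_{s\ge0}\overline{\bigcup_{t\ge s}\varphi^{t}(v_{0})}$ (closures in $\mathbb{E}$). A complete trajectory passing through $w_0$ is a continuous map $w\colon\mathbb{R}\to\mathbb{E}$ with $w(t+s)=\varphi^{t}(w(s))$ for all $t\ge0$, $s\in\mathbb{R}$, and $w(0)=w_{0}$. A stationary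 point $v_{0}$ ($\varphi^{t}(v_{0})=v_{0}$ for all $t\ge 0$) is Lyapunov stable if for every $\varepsilon>0$ there is $\delta>0$ such that $\|\varphi^{t}(v)-v_{0}\|_{\mathbb{E}}<\varepsilon$ for all $t\ge0$ whenever $\|v-v_{0}\|_{\mathbb{E}}<\delta$. A set $\mathcal{D}\subset\mathbb{E}$ containing a stationary point $v_{0}$ is a $k$-dimensional (local) unstable set for $v_{0}$ if: (U1) $\mathcal{D}$ is a homeomorphic image of an open $k$-dimensional cube; (U2) for every $w_{0}\in\mathcal{D}$ there is a unique complete trajectory $w(\cdot)$ passing through $w(0)=w_{0}$, and $w(t)\to v_{0}$ as $t\to-\infty$; (U3) for every $\varepsilon>0$ there is $\delta>0$ such that if $w_{0}\in\mathcal{D}$ and $\|w_{0}-v_{0}\|_{\mathbb{E}}<\delta$, then $\|w(t)-v_{0}\|_{\mathbb{E}}<\varepsilon$ for all $t\le0$, where $w(\cdot)$ is the complete trajectory from (U2). A stationary point $v_{0}\in\mathbb{E}$ is terminal if either it is Lyapunov stable or there is a $2$-dimensional unstable set for $v_{0}$. *)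

theory Defs
  imports "HOL-Analysis.Analysis"
begin

text \<open>
  A semiflow is represented by a function on all of \<open>real\<close>; its values at negative times
  are irrelevant and never constrained.
\<close>

definition semiflow :: "(real \<Rightarrow> 'e::banach \<Rightarrow> 'e) \<Rightarrow> bool" where
  "semiflow \<phi> \<longleftrightarrow>
     (\<forall>v. \<phi> 0 v = v) \<and>
     (\<forall>t\<ge>0. \<forall>s\<ge>0. \<forall>v. \<phi> (t + s) v = \<phi> t (\<phi> s v)) \<and>
     continuous_on ({0..} \<times> UNIV) (\<lambda>(t, v). \<phi> t v)"

definition continuous_embedding :: "('e::real_normed_vector \<Rightarrow> 'h::real_normed_vector) \<Rightarrow> bool" where
  "continuous_embedding \<iota> \<longleftrightarrow> bounded_linear \<iota> \<and> inj \<iota>"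

definition pairing :: "'e::real_normed_vector \<Rightarrow> ('e \<Rightarrow>\<^sub>L real) \<Rightarrow> real" where
  "pairing v f = blinfun_apply f v"

definition symmetric_op :: "('e::real_normed_vector \<Rightarrow>\<^sub>L ('e \<Rightarrow>\<^sub>L real)) \<Rightarrow> bool" where
  "symmetric_op P \<longleftrightarrow>
     (\<forall>v w. pairing v (blinfun_apply P w) = pairing w (blinfun_apply P v))"

definition quad_form :: "('e::real_normed_vector \<Rightarrow>\<^sub>L ('e \<Rightarrow>\<^sub>L real)) \<Rightarrow> 'e \<Rightarrow> real" where
  "quad_form P v = pairing v (blinfun_apply P v)"

definition positive_on ::
    "('e::real_normed_vector \<Rightarrow>\<^sub>L ('e \<Rightarrow>\<^sub>L real)) \<Rightarrow> 'e set \<Rightarrow> bool" where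
  "positive_on P L \<longleftrightarrow> (\<forall>v\<in>L. v \<noteq> 0 \<longrightarrow> pairing v (blinfun_apply P v) > 0)"

definition negative_on ::
    "('e::real_normed_vector \<Rightarrow>\<^sub>L ('e \<Rightarrow>\<^sub>L real)) \<Rightarrow> 'e set \<Rightarrow> bool" where
  "negative_on P L \<longleftrightarrow> (\<forall>v\<in>L. v \<noteq> 0 \<longrightarrow> pairing v (blinfun_apply P v) < 0)"

text \<open>The summands are linear subspaces; no closedness is imposed on them.\<close>

definition direct_sum_splitting :: "'e::real_vector set \<Rightarrow> 'e set \<Rightarrow> bool" where
  "direct_sum_splitting A B \<longleftrightarrow>
     subspace A \<and> subspace B \<and> A \<inter> B = {0} \<and> (\<forall>v. \<exists>a\<in>A. \<exists>b\<in>B. v = a + b)"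

definition compact_map :: "('e::metric_space \<Rightarrow> 'f::topological_space) \<Rightarrow> bool" where
  "compact_map f \<longleftrightarrow> (\<forall>B. bounded B \<longrightarrow> compact (closure (f ` B)))"

definition positive_semiorbit :: "(real \<Rightarrow> 'e \<Rightarrow> 'e) \<Rightarrow> 'e \<Rightarrow> 'e set" where
  "positive_semiorbit \<phi> v\<^sub>0 = (\<lambda>t. \<phi> t v\<^sub>0) ` {0..}"

definition omega_limit :: "(real \<Rightarrow> 'e::topological_space \<Rightarrow> 'e) \<Rightarrow> 'e \<Rightarrow> 'e set" where
  "omega_limit \<phi> v\<^sub>0 = (\<Inter>s\<in>{0..}. closure ((\<lambda>t. \<phi> t v\<^sub>0) ` {s..}))"

definition complete_trajectory_through ::
    "(real \<Rightarrow> 'e::topological_space \<Rightarrow> 'e) \<Rightarrow> 'e \<Rightarrow> (real \<Rightarrow> 'e) \<Rightarrow> bool" where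
  "complete_trajectory_through \<phi> w\<^sub>0 w \<longleftrightarrow>
     continuous_on UNIV w \<and> (\<forall>t\<ge>0. \<forall>s. w (t + s) = \<phi> t (w s)) \<and> w 0 = w\<^sub>0"

definition stationary_point :: "(real \<Rightarrow> 'e \<Rightarrow> 'e) \<Rightarrow> 'e \<Rightarrow> bool" where
  "stationary_point \<phi> v\<^sub>0 \<longleftrightarrow> (\<forall>t\<ge>0. \<phi> t v\<^sub>0 = v\<^sub>0)"

definition lyapunov_stable :: "(real \<Rightarrow> 'e::real_normed_vector \<Rightarrow> 'e) \<Rightarrow> 'e \<Rightarrow> bool" where
  "lyapunov_stable \<phi> v\<^sub>0 \<longleftrightarrow>
     (\<forall>\<epsilon>>0. \<exists>\<delta>>0. \<forall>v. norm (v - v\<^sub>0) < \<delta> \<longrightarrow> (\<forall>t\<ge>0. norm (\<phi> t v - v\<^sub>0) < \<epsilon>))"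

text \<open>
  The dimension of the unstable set is the cardinality of the index type \<open>'k\<close>, passed as a
  type argument. The conjuncts after \<open>v\<^sub>0 \<in> D\<close> are the homeomorphism to the open unit cube
  of \<open>real^'k\<close>, existence and uniqueness of the complete trajectory through each point of
  \<open>D\<close> together with its convergence to \<open>v\<^sub>0\<close> in backward time, and backward stability.
  Since that trajectory is unique, quantifying universally over complete trajectories
  through \<open>w\<^sub>0\<close> refers precisely to it.
\<close>

definition unstable_set ::
    "'k::finite itself \<Rightarrow> (real \<Rightarrow> 'e::real_normed_vector \<Rightarrow> 'e) \<Rightarrow> 'e \<Rightarrow> 'e set \<Rightarrow> bool" where
  "unstable_set TYPE('k) \<phi> v\<^sub>0 D \<longleftrightarrow>
     v\<^sub>0 \<in> D \<and>
     {x :: real^'k. \<forall>i. 0 < x $ i \<and> x $ i < 1} homeomorphic D \<and>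
     (\<forall>w\<^sub>0\<in>D. (\<exists>!w. complete_trajectory_through \<phi> w\<^sub>0 w) \<and>
        (\<forall>w. complete_trajectory_through \<phi> w\<^sub>0 w \<longrightarrow> (w \<longlongrightarrow> v\<^sub>0) at_bot)) \<and>
     (\<forall>\<epsilon>>0. \<exists>\<delta>>0. \<forall>w\<^sub>0\<in>D. norm (w\<^sub>0 - v\<^sub>0) < \<delta> \<longrightarrow>
        (\<forall>w. complete_trajectory_through \<phi> w\<^sub>0 w \<longrightarrow> (\<forall>t\<le>0. norm (w t - v\<^sub>0) < \<epsilon>)))"

definition terminal_point :: "(real \<Rightarrow> 'e::real_normed_vector \<Rightarrow> 'e) \<Rightarrow> 'e \<Rightarrow> bool" where
  "terminal_point \<phi> v\<^sub>0 \<longleftrightarrow>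
     stationary_point \<phi> v\<^sub>0 \<and>
     (lyapunov_stable \<phi> v\<^sub>0 \<or> (\<exists>D. unstable_set TYPE(2) \<phi> v\<^sub>0 D))"

end

theory Submission
  imports Defs
begin

text \<open>
  If the terminal point \<open>v\<^sub>0\<close> is Lyapunov stable, an orbit that comes close to it once stays
  close to it, and the claim is immediate. The substance is the case of a two-dimensional
  unstable set \<open>D\<close>.

  The squeezing inequality makes \<open>V(p - q)\<close> negative for any two distinct points \<open>p\<close>, \<open>q\<close> lying
  on complete trajectories that are bounded in backward time: the difference of the
  trajectories grows slower than \<open>e\<^sup>-\<^sup>\<nu>\<^sup>t\<close> as \<open>t \<rightarrow> -\<infinity>\<close>, so
  only the negative integral term survives (\<open>squeezing_negative\<close>). On the other hand \<open>V \<ge> 0\<close> on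
  the \<open>P\<close>-orthogonal complement of the plane \<open>E\<^sup>-\<close>. Hence the map \<open>\<pi>\<close> to \<open>real^2\<close> that pairs a
  vector with a basis of \<open>E\<^sup>-\<close> is injective on the set of all such points
  (\<open>negative_form_projection\<close>). Both \<open>D\<close> and the compact invariant set \<open>\<omega>(w\<^sub>0)\<close> consist of such
  points. Since \<open>D\<close> is a two-dimensional cell, invariance of domain makes \<open>\<pi>(D)\<close> open in the
  plane, and injectivity then forces the part of \<open>\<omega>(w\<^sub>0)\<close> in a small ball around \<open>v\<^sub>0\<close> to lie in
  \<open>D\<close> (\<open>homeomorphic_injective_image_absorbs\<close>).

  Suppose now that \<open>\<omega>(w\<^sub>0)\<close> contains another point. The orbit of \<open>w\<^sub>0\<close> then crosses a small sphere
  around \<open>v\<^sub>0\<close> infinitely often on its way towards \<open>v\<^sub>0\<close>, and a limit \<open>y\<close> of the last crossing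
  points is a point of \<open>\<omega>(w\<^sub>0)\<close> on the sphere whose forward orbit never leaves the ball
  (\<open>omega_limit_incoming_point\<close>), hence stays in \<open>D\<close>. But points of \<open>D\<close> flow out of \<open>v\<^sub>0\<close>: a
  complete trajectory inside \<open>\<omega>(y)\<close> tends to \<open>v\<^sub>0\<close> in backward time, so \<open>v\<^sub>0 \<in> \<omega>(y)\<close>; thus the
  orbit of \<open>y\<close> returns arbitrarily near to \<open>v\<^sub>0\<close>, and following it back from there to \<open>y\<close>
  contradicts the backward stability of \<open>D\<close> (\<open>orbit_not_trapped_in_unstable_set\<close>).
\<close>

section \<open>Orbits of semiflows and their limit sets\<close>

lemma semiflow_tendsto:
  assumes "semiflow \<phi>" "(t \<longlongrightarrow> T) F" "(v \<longlongrightarrow> p) F" "\<forall>\<^sub>F n in F. t n \<ge> 0" "T \<ge> 0"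
  shows "((\<lambda>n. \<phi> (t n) (v n)) \<longlongrightarrow> \<phi> T p) F"
proof -
  have "continuous_on ({0..} \<times> UNIV) (\<lambda>(t, v). \<phi> t v)"
    using assms(1) by (simp add: semiflow_def)
  from continuous_on_tendsto_compose[OF this tendsto_Pair[OF assms(2,3)]] assms(4,5)
  show ?thesis by simp
qed

lemma semiflow_continuous_on:
  assumes "semiflow \<phi>" "continuous_on S f" "continuous_on S g" "\<And>s. s \<in> S \<Longrightarrow> f s \<ge> 0"
  shows "continuous_on S (\<lambda>s. \<phi> (f s) (g s))"
proof -
  have "continuous_on ({0..} \<times> UNIV) (\<lambda>(t, v). \<phi> t v)"
    using assms(1) by (simp add: semiflow_def)
  from continuous_on_compose2[OF this continuous_on_Pair[OF assms(2,3)]] assms(4)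
  show ?thesis by auto
qed

lemma semiflow_add:
  "semiflow \<phi> \<Longrightarrow> t \<ge> 0 \<Longrightarrow> s \<ge> 0 \<Longrightarrow> \<phi> (t + s) v = \<phi> t (\<phi> s v)"
  by (simp add: semiflow_def)

lemma semiflow_zero: "semiflow \<phi> \<Longrightarrow> \<phi> 0 v = v"
  by (simp add: semiflow_def)

lemma omega_limit_sequence:
  fixes \<phi> :: "real \<Rightarrow> 'e::banach \<Rightarrow> 'e"
  assumes "p \<in> omega_limit \<phi> w"
  obtains t where "\<And>n. t n \<ge> real n" "(\<lambda>n. \<phi> (t n) w) \<longlonglongrightarrow> p"
proof -
  have "\<exists>t\<ge>real n. dist (\<phi> t w) p < inverse (real (Suc n))" for n
  proof -
    have "p \<in> closure ((\<lambda>t. \<phi> t w) ` {real n..})"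
      using assms unfolding omega_limit_def by auto
    then show ?thesis
      unfolding closure_approachable
      by (metis (no_types, lifting) atLeast_iff imageE inverse_positive_iff_positive of_nat_0_less_iff zero_less_Suc)
  qed
  then obtain t where t: "\<And>n. t n \<ge> real n" "\<And>n. dist (\<phi> (t n) w) p < inverse (real (Suc n))"
    by metis
  have "(\<lambda>n. dist (\<phi> (t n) w) p) \<longlonglongrightarrow> 0"
    by (rule tendsto_sandwich[OF _ _ tendsto_const LIMSEQ_inverse_real_of_nat])
       (use t(2) in \<open>auto intro!: always_eventually less_imp_le\<close>)
  then show thesis using that t(1) tendsto_dist_iff by blast
qed

lemma omega_limitI:
  fixes \<phi> :: "real \<Rightarrow> 'e::banach \<Rightarrow> 'e"
  assumes "filterlim t at_top sequentially" "(\<lambda>n. \<phi> (t n) w) \<longlonglongrightarrow> p"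
  shows "p \<in> omega_limit \<phi> w"
  unfolding omega_limit_def
proof (rule INT_I)
  fix s :: real
  have "\<forall>\<^sub>F n in sequentially. t n \<ge> s"
    using assms(1) by (simp add: filterlim_at_top)
  then have "\<forall>\<^sub>F n in sequentially. \<phi> (t n) w \<in> closure ((\<lambda>t. \<phi> t w) ` {s..})"
    by (rule eventually_mono) (meson atLeast_iff closure_subset image_eqI subsetD)
  from Lim_in_closed_set[OF closed_closure this _ assms(2)]
  show "p \<in> closure ((\<lambda>t. \<phi> t w) ` {s..})" by simp
qed

lemma closed_omega_limit: "closed (omega_limit \<phi> w)"
  unfolding omega_limit_def by auto

lemma omega_limit_subset:
  assumes "closed K" "T \<ge> 0" "\<And>t. t \<ge> T \<Longrightarrow> \<phi> t w \<in> K"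
  shows "omega_limit \<phi> w \<subseteq> K"
proof -
  have "closure ((\<lambda>t. \<phi> t w) ` {T..}) \<subseteq> K"
    using assms by (intro closure_minimal) auto
  then show ?thesis using assms(2) unfolding omega_limit_def by auto
qed

lemma omega_limit_forward_invariant:
  fixes \<phi> :: "real \<Rightarrow> 'e::banach \<Rightarrow> 'e"
  assumes "semiflow \<phi>" "p \<in> omega_limit \<phi> w" "t \<ge> 0"
  shows "\<phi> t p \<in> omega_limit \<phi> w"
proof -
  obtain s where s: "\<And>n. s n \<ge> real n" "(\<lambda>n. \<phi> (s n) w) \<longlonglongrightarrow> p"
    by (rule omega_limit_sequence[OF assms(2)]) blast
  have lim: "filterlim (\<lambda>n. t + s n) at_top sequentially"
    by (rule filterlim_at_top_mono[OF filterlim_real_sequentially])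
       (use s(1) assms(3) in \<open>auto intro!: always_eventually add_increasing\<close>)
  have "\<phi> (t + s n) w = \<phi> t (\<phi> (s n) w)" for n
    using assms(1,3) s(1)[of n] by (intro semiflow_add) auto
  moreover have "(\<lambda>n. \<phi> t (\<phi> (s n) w)) \<longlonglongrightarrow> \<phi> t p"
    by (rule semiflow_tendsto[OF assms(1) tendsto_const s(2)]) (use assms(3) in auto)
  ultimately show ?thesis by (intro omega_limitI[OF lim]) simp
qed

lemma omega_limit_nonempty:
  fixes \<phi> :: "real \<Rightarrow> 'e::banach \<Rightarrow> 'e"
  assumes "compact K" "\<And>t. t \<ge> T \<Longrightarrow> \<phi> t w \<in> K"
  shows "omega_limit \<phi> w \<noteq> {}"
proof -
  have "\<forall>n. \<phi> (real n + T) w \<in> K" using assms(2) by simp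
  with assms(1) obtain l r where r: "strict_mono r" "((\<lambda>n. \<phi> (real n + T) w) \<circ> r) \<longlonglongrightarrow> l"
    unfolding compact_def by metis
  have "filterlim (\<lambda>n. real (r n) + T) at_top sequentially"
    using filterlim_compose[OF filterlim_real_sequentially filterlim_subseq[OF r(1)]]
    by (simp add: filterlim_tendsto_add_at_top add.commute[of _ T] filterlim_tendsto_add_at_top[OF tendsto_const])
  then show ?thesis using omega_limitI r(2) by (fastforce simp: o_def)
qed

text \<open>
  If \<open>\<phi>(s\<^sub>n, w)\<close> tends to \<open>p\<close>, precompactness yields a limit point of the orbit at the earlier
  times \<open>s\<^sub>n - t\<close>, which the flow carries to \<open>p\<close>.
\<close>

lemma omega_limit_backward_invariant:
  fixes \<phi> :: "real \<Rightarrow> 'e::banach \<Rightarrow> 'e"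
  assumes "semiflow \<phi>" "compact K" "\<And>t. t \<ge> T \<Longrightarrow> \<phi> t w \<in> K"
    and "p \<in> omega_limit \<phi> w" "t \<ge> 0"
  shows "\<exists>q\<in>omega_limit \<phi> w. \<phi> t q = p"
proof -
  obtain s where s: "\<And>n. s n \<ge> real n" "(\<lambda>n. \<phi> (s n) w) \<longlonglongrightarrow> p"
    by (rule omega_limit_sequence[OF assms(4)]) blast
  obtain N :: nat where N: "real N \<ge> \<bar>T\<bar> + t" using real_arch_simple by blast
  \<comment> \<open>Skipping \<open>N\<close> terms keeps the shifted times \<open>s\<^sub>n - t\<close> beyond \<open>T\<close> and above \<open>n\<close>.\<close>
  define f where "f = (\<lambda>n. s (n + N) - t)"
  have f: "f n \<ge> real n" "f n \<ge> T" "f n \<ge> 0" for n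
    using s(1)[of "n + N"] N by (auto simp: f_def)
  have "\<forall>n. \<phi> (f n) w \<in> K" using assms(3) f(2) by simp
  with assms(2) obtain q r where r: "strict_mono r" "((\<lambda>n. \<phi> (f n) w) \<circ> r) \<longlonglongrightarrow> q"
    unfolding compact_def by metis
  have "filterlim (\<lambda>n. f (r n)) at_top sequentially"
    by (rule filterlim_at_top_mono[OF filterlim_compose[OF filterlim_real_sequentially filterlim_subseq[OF r(1)]]])
       (simp add: f(1))
  then have q: "q \<in> omega_limit \<phi> w" using omega_limitI r(2) by (fastforce simp: o_def)
  have "(\<lambda>n. \<phi> t (\<phi> (f (r n)) w)) \<longlonglongrightarrow> \<phi> t q"
    by (rule semiflow_tendsto[OF assms(1) tendsto_const r(2)[unfolded o_def]]) (use assms(5) in auto)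
  moreover have "\<phi> t (\<phi> (f (r n)) w) = \<phi> (s (r n + N)) w" for n
    using semiflow_add[OF assms(1,5) f(3)[of "r n"], of w] by (simp add: f_def)
  moreover have "(\<lambda>n. \<phi> (s (r n + N)) w) \<longlonglongrightarrow> p"
    using LIMSEQ_subseq_LIMSEQ[OF LIMSEQ_ignore_initial_segment[OF s(2), of N] r(1)]
    by (simp add: o_def)
  ultimately have "\<phi> t q = p" using LIMSEQ_unique by force
  then show ?thesis using q by blast
qed

text \<open>
  Choosing preimages under the time-one map repeatedly gives a backward orbit at integer times;
  the flow fills in the times between.
\<close>

lemma complete_trajectory_in_invariant_set:
  fixes \<phi> :: "real \<Rightarrow> 'e::banach \<Rightarrow> 'e"
  assumes sf: "semiflow \<phi>"
    and fwd: "\<And>p t. p \<in> M \<Longrightarrow> t \<ge> 0 \<Longrightarrow> \<phi> t p \<in> M"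
    and bwd: "\<And>p. p \<in> M \<Longrightarrow> \<exists>q\<in>M. \<phi> 1 q = p"
    and "p \<in> M"
  obtains u where "complete_trajectory_through \<phi> p u" "range u \<subseteq> M"
proof -
  have "\<exists>f. \<forall>n. (f n \<in> M \<and> (n = 0 \<longrightarrow> f n = p)) \<and> \<phi> 1 (f (Suc n)) = f n"
    by (rule dependent_nat_choice) (use assms(4) bwd in auto)
  then obtain f where f: "\<And>n. f n \<in> M" "f 0 = p" "\<And>n. \<phi> 1 (f (Suc n)) = f n"
    by auto
  have pull: "\<phi> (real j) (f (k + j)) = f k" for j k
  proof (induction j)
    case 0
    then show ?case using sf by (simp add: semiflow_zero)
  next
    case (Suc j)
    have "\<phi> (real j + 1) (f (k + Suc j)) = \<phi> (real j) (\<phi> 1 (f (Suc (k + j))))"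
      using sf by (subst semiflow_add) auto
    then show ?case using Suc f(3) by (simp add: add.commute)
  qed
  define u where "u t = \<phi> (t + real (nat \<lceil>\<bar>t\<bar>\<rceil>)) (f (nat \<lceil>\<bar>t\<bar>\<rceil>))" for t
  \<comment> \<open>The value at \<open>t\<close> may be computed from any point of the backward sequence lying before
    time \<open>t\<close>.\<close>
  have u_eq: "u t = \<phi> (t + real k) (f k)" if "t + real k \<ge> 0" for t k
  proof -
    have *: "\<phi> (t + real (m + j)) (f (m + j)) = \<phi> (t + real m) (f m)" if "t + real m \<ge> 0" for m j
    proof -
      have "\<phi> (t + real m + real j) (f (m + j)) = \<phi> (t + real m) (\<phi> (real j) (f (m + j)))"
        using sf that by (intro semiflow_add) auto
      then show ?thesis using pull by (simp add: add.assoc)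
    qed
    define m where "m = nat \<lceil>\<bar>t\<bar>\<rceil>"
    have m: "t + real m \<ge> 0" unfolding m_def by linarith
    have "u t = \<phi> (t + real m) (f m)" by (simp only: u_def m_def)
    moreover have "\<phi> (t + real m) (f m) = \<phi> (t + real k) (f k)"
    proof (cases "k \<le> m")
      case True
      then have "k + (m - k) = m" by simp
      with *[OF that, of "m - k"] show ?thesis by simp
    next
      case False
      then have "m + (k - m) = k" by simp
      with *[OF m, of "k - m"] show ?thesis by simp
    qed
    ultimately show ?thesis by simp
  qed
  have "continuous (at t) u" for t
  proof -
    obtain k :: nat where k: "real k > - t" using reals_Archimedean2 by blast
    have "continuous_on {- real k<..} (\<lambda>t. \<phi> (t + real k) (f k))"
      by (rule semiflow_continuous_on[OF sf]) (auto intro!: continuous_intros)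
    then have "continuous_on {- real k<..} u"
      by (rule continuous_on_eq) (rule u_eq[symmetric], simp)
    then show ?thesis
      using k by (simp add: continuous_on_eq_continuous_at)
  qed
  then have "continuous_on UNIV u" by (simp add: continuous_on_eq_continuous_at)
  moreover have "u (t + s) = \<phi> t (u s)" if "t \<ge> 0" for t s
  proof -
    obtain k :: nat where k: "real k > - s" using reals_Archimedean2 by blast
    have "\<phi> (t + (s + real k)) (f k) = \<phi> t (\<phi> (s + real k) (f k))"
      using sf that k by (intro semiflow_add) auto
    then show ?thesis using u_eq[of s k] u_eq[of "t + s" k] k that by (simp add: add.assoc)
  qed
  moreover have "u 0 = p" using u_eq[of 0 0] f(2) sf by (simp add: semiflow_zero)
  moreover have "range u \<subseteq> M"
  proof
    fix x assume "x \<in> range u"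
    then obtain t where "x = u t" by blast
    moreover obtain k :: nat where "real k > - t" using reals_Archimedean2 by blast
    ultimately show "x \<in> M" using u_eq[of t k] fwd[OF f(1), of "t + real k" k] by simp
  qed
  ultimately show thesis
    using that unfolding complete_trajectory_through_def by blast
qed

lemma omega_limit_complete_trajectory:
  fixes \<phi> :: "real \<Rightarrow> 'e::banach \<Rightarrow> 'e"
  assumes "semiflow \<phi>" "compact K" "\<And>t. t \<ge> T \<Longrightarrow> \<phi> t w \<in> K" "p \<in> omega_limit \<phi> w"
  obtains u where "complete_trajectory_through \<phi> p u" "range u \<subseteq> omega_limit \<phi> w"
  using complete_trajectory_in_invariant_set[OF assms(1), of "omega_limit \<phi> w" p]
    omega_limit_forward_invariant[OF assms(1)]
    omega_limit_backward_invariant[OF assms(1-3)] assms(4) zero_le_one by metis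

lemma shift_complete_trajectory:
  assumes "complete_trajectory_through \<phi> p u"
  shows "complete_trajectory_through \<phi> (u s) (\<lambda>t. u (t + s))"
proof -
  have "continuous_on UNIV u" using assms by (simp add: complete_trajectory_through_def)
  then have "continuous_on UNIV (\<lambda>t. u (t + s))"
    by (rule continuous_on_compose2) (auto intro!: continuous_intros)
  then show ?thesis
    using assms unfolding complete_trajectory_through_def by (simp add: add.assoc)
qed

lemma orbit_last_on_sphere:
  fixes \<phi> :: "real \<Rightarrow> 'e::banach \<Rightarrow> 'e"
  assumes sf: "semiflow \<phi>" and "0 \<le> a" "a \<le> b"
    and "\<epsilon> \<le> dist (\<phi> a w) v" "dist (\<phi> b w) v \<le> \<epsilon>"
  obtains s where "a \<le> s" "s \<le> b" "dist (\<phi> s w) v = \<epsilon>"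
    "\<And>t. s \<le> t \<Longrightarrow> t \<le> b \<Longrightarrow> dist (\<phi> t w) v \<le> \<epsilon>"
proof -
  have cont: "continuous_on {c..b} (\<lambda>s. dist (\<phi> s w) v)" if "a \<le> c" for c
    using that assms(2)
    by (intro continuous_intros semiflow_continuous_on[OF sf]) auto
  define S where "S = {a..b} \<inter> (\<lambda>s. dist (\<phi> s w) v) -` {\<epsilon>..}"
  have "closed S"
    unfolding S_def by (rule continuous_closed_preimage) (auto intro: cont)
  then have "compact S"
    by (metis S_def compact_Icc compact_Int_closed inf.right_idem inf_commute inf_left_commute)
  moreover have "S \<noteq> {}" using assms by (auto simp: S_def)
  ultimately obtain s where s: "s \<in> S" "\<And>t. t \<in> S \<Longrightarrow> t \<le> s"
    using compact_attains_sup by metis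
  have "\<exists>x\<ge>s. x \<le> b \<and> dist (\<phi> x w) v = \<epsilon>"
    by (rule IVT2') (use s(1) assms cont in \<open>auto simp: S_def\<close>)
  then obtain x where x: "s \<le> x" "x \<le> b" "dist (\<phi> x w) v = \<epsilon>" by blast
  then have "x \<in> S" using s(1) by (auto simp: S_def)
  then have "x = s" using s(2) x(1) by fastforce
  show thesis
  proof
    show "dist (\<phi> t w) v \<le> \<epsilon>" if "s \<le> t" "t \<le> b" for t
    proof (rule ccontr)
      assume gt: "\<not> ?thesis"
      then have "t \<in> S" using that s(1) by (auto simp: S_def)
      then have "t = s" using s(2) that by force
      then show False using x \<open>x = s\<close> gt by simp
    qed
  qed (use s(1) x \<open>x = s\<close> in \<open>auto simp: S_def\<close>)
qed

text \<open>
  The point \<open>y\<close> is a limit of the last points on the sphere of radius \<open>\<epsilon>\<close> before ever closer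
  approaches of the orbit to \<open>v\<close>. The orbit segments from the sphere to the close approach stay in
  the ball. A fixed time \<open>t\<close> is either covered by infinitely many of them, which bounds
  \<open>\<phi>(t, y)\<close> by continuity, or the segments have bounded length, and then the orbit of \<open>y\<close>
  reaches the stationary point \<open>v\<close> by time \<open>t\<close> and rests there.
\<close>

lemma omega_limit_incoming_point:
  fixes \<phi> :: "real \<Rightarrow> 'e::banach \<Rightarrow> 'e"
  assumes sf: "semiflow \<phi>" and K: "compact K" "\<And>t. t \<ge> T \<Longrightarrow> \<phi> t w \<in> K"
    and v: "stationary_point \<phi> v" "v \<in> omega_limit \<phi> w"
    and p: "p \<in> omega_limit \<phi> w" and \<epsilon>: "0 < \<epsilon>" "\<epsilon> < dist p v"
  obtains y where "y \<in> omega_limit \<phi> w" "dist y v = \<epsilon>" "\<And>t. t \<ge> 0 \<Longrightarrow> dist (\<phi> t y) v \<le> \<epsilon>"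
proof -
  obtain tp where tp: "\<And>n. tp n \<ge> real n" "(\<lambda>n. \<phi> (tp n) w) \<longlonglongrightarrow> p"
    by (rule omega_limit_sequence[OF p]) blast
  obtain tv where tv: "\<And>n. tv n \<ge> real n" "(\<lambda>n. \<phi> (tv n) w) \<longlonglongrightarrow> v"
    by (rule omega_limit_sequence[OF v(2)]) blast
  have far: "\<exists>a\<ge>c. dist (\<phi> a w) v > \<epsilon>" for c
  proof -
    have "\<forall>\<^sub>F n in sequentially. dist (\<phi> (tp n) w) v > \<epsilon>"
      by (rule order_tendstoD(1)[OF tendsto_dist[OF tp(2) tendsto_const] \<epsilon>(2)])
    moreover have "\<forall>\<^sub>F n in sequentially. real n \<ge> c"
      using filterlim_real_sequentially by (simp add: filterlim_at_top)
    ultimately have "\<forall>\<^sub>F n in sequentially. dist (\<phi> (tp n) w) v > \<epsilon> \<and> real n \<ge> c"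
      by (rule eventually_conj)
    then obtain n where "dist (\<phi> (tp n) w) v > \<epsilon>" "real n \<ge> c"
      using eventually_happens'[OF sequentially_bot] by blast
    then show ?thesis using tp(1)[of n] by (intro exI[of _ "tp n"]) auto
  qed
  have near: "\<exists>b\<ge>c. dist (\<phi> b w) v < e" if "e > 0" for c e
  proof -
    have "\<forall>\<^sub>F n in sequentially. dist (\<phi> (tv n) w) v < e"
      using tv(2) that by (rule tendstoD)
    moreover have "\<forall>\<^sub>F n in sequentially. real n \<ge> c"
      using filterlim_real_sequentially by (simp add: filterlim_at_top)
    ultimately have "\<forall>\<^sub>F n in sequentially. dist (\<phi> (tv n) w) v < e \<and> real n \<ge> c"
      by (rule eventually_conj)
    then obtain n where "dist (\<phi> (tv n) w) v < e" "real n \<ge> c"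
      using eventually_happens'[OF sequentially_bot] by blast
    then show ?thesis using tv(1)[of n] by (intro exI[of _ "tv n"]) auto
  qed
  define last_approach where "last_approach n s b \<longleftrightarrow>
      real n + \<bar>T\<bar> \<le> s \<and> s \<le> b \<and> dist (\<phi> s w) v = \<epsilon> \<and>
      dist (\<phi> b w) v < inverse (real (Suc n)) \<and>
      (\<forall>t. s \<le> t \<longrightarrow> t \<le> b \<longrightarrow> dist (\<phi> t w) v \<le> \<epsilon>)" for n s b
  have "\<exists>s b. last_approach n s b" for n
  proof -
    obtain a where a: "a \<ge> real n + \<bar>T\<bar>" "dist (\<phi> a w) v > \<epsilon>" using far by blast
    obtain b where b: "b \<ge> a" "dist (\<phi> b w) v < min \<epsilon> (inverse (real (Suc n)))"
      using near[of "min \<epsilon> (inverse (real (Suc n)))"] \<epsilon>(1) by auto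
    obtain s where "a \<le> s" "s \<le> b" "dist (\<phi> s w) v = \<epsilon>"
      "\<And>t. s \<le> t \<Longrightarrow> t \<le> b \<Longrightarrow> dist (\<phi> t w) v \<le> \<epsilon>"
      by (rule orbit_last_on_sphere[OF sf, of a b \<epsilon> w v]) (use a b in auto)
    then show ?thesis using a b by (intro exI[of _ s] exI[of _ b]) (auto simp: last_approach_def)
  qed
  then obtain s b where "\<And>n. last_approach n (s n) (b n)" by metis
  then have s: "\<And>n. real n + \<bar>T\<bar> \<le> s n" "\<And>n. s n \<le> b n"
      "\<And>n. dist (\<phi> (s n) w) v = \<epsilon>"
    and b: "\<And>n. dist (\<phi> (b n) w) v < inverse (real (Suc n))"
    and sb: "\<And>n t. s n \<le> t \<Longrightarrow> t \<le> b n \<Longrightarrow> dist (\<phi> t w) v \<le> \<epsilon>"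
    by (simp_all add: last_approach_def)
  have b_lim: "(\<lambda>n. \<phi> (b n) w) \<longlonglongrightarrow> v"
    by (rule tendsto_dist_iff[THEN iffD2], rule tendsto_sandwich[OF _ _ tendsto_const LIMSEQ_inverse_real_of_nat])
       (use b in \<open>auto intro!: always_eventually less_imp_le\<close>)
  have s0: "s n \<ge> 0" "s n \<ge> real n" "s n \<ge> T" for n using s(1)[of n] by auto
  have "\<forall>n. \<phi> (s n) w \<in> K" using K(2) s0(3) by simp
  with K(1) obtain y r where r: "strict_mono r" and "((\<lambda>n. \<phi> (s n) w) \<circ> r) \<longlonglongrightarrow> y"
    unfolding compact_def by metis
  then have y: "(\<lambda>n. \<phi> (s (r n)) w) \<longlonglongrightarrow> y" by (simp add: o_def)
  have "filterlim (\<lambda>n. s (r n)) at_top sequentially"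
    by (rule filterlim_at_top_mono[OF filterlim_compose[OF filterlim_real_sequentially filterlim_subseq[OF r]]])
       (simp add: s0(2))
  then have y_omega: "y \<in> omega_limit \<phi> w" using y by (rule omega_limitI)
  have "(\<lambda>n. dist (\<phi> (s (r n)) w) v) \<longlonglongrightarrow> dist y v"
    by (intro tendsto_intros y)
  then have dist_y: "dist y v = \<epsilon>" using s(3) by (simp add: LIMSEQ_const_iff)
  have "dist (\<phi> t y) v \<le> \<epsilon>" if t: "t \<ge> 0" for t
  proof (rule ccontr)
    assume contra: "\<not> ?thesis"
    have "(\<lambda>n. dist (\<phi> t (\<phi> (s (r n)) w)) v) \<longlonglongrightarrow> dist (\<phi> t y) v"
      using t by (intro tendsto_intros semiflow_tendsto[OF sf] y) auto
    then have "\<forall>\<^sub>F n in sequentially. \<epsilon> < dist (\<phi> t (\<phi> (s (r n)) w)) v"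
      using contra by (intro order_tendstoD(1)) auto
    then obtain N where N: "\<And>n. n \<ge> N \<Longrightarrow> \<epsilon> < dist (\<phi> t (\<phi> (s (r n)) w)) v"
      by (auto simp: eventually_sequentially)
    \<comment> \<open>The durations of the segments, all at most \<open>t\<close> from index \<open>N\<close> on.\<close>
    define c where "c n = b (r (n + N)) - s (r (n + N))" for n
    have c: "c n \<in> {0..t}" for n
    proof (rule ccontr)
      assume "c n \<notin> {0..t}"
      then have "t + s (r (n + N)) \<le> b (r (n + N))"
        using s(2)[of "r (n + N)"] by (auto simp: c_def)
      from sb[OF _ this] N[of "n + N"] show False
        using t s0(1) by (simp add: semiflow_add[OF sf])
    qed
    obtain l q where l: "l \<in> {0..t}" and q: "strict_mono q" and "(c \<circ> q) \<longlonglongrightarrow> l"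
      using compact_Icc[of 0 t] c unfolding compact_def by metis
    then have c_lim: "(\<lambda>n. c (q n)) \<longlonglongrightarrow> l" by (simp add: o_def)
    have qN: "filterlim (\<lambda>n. q n + N) sequentially sequentially"
      by (rule filterlim_at_top_mono[OF filterlim_subseq[OF q]]) simp
    have "(\<lambda>n. \<phi> (c (q n)) (\<phi> (s (r (q n + N))) w)) \<longlonglongrightarrow> \<phi> l y"
      using l c by (intro semiflow_tendsto[OF sf] c_lim filterlim_compose[OF y qN]) auto
    moreover have "\<phi> (c (q n)) (\<phi> (s (r (q n + N))) w) = \<phi> (b (r (q n + N))) w" for n
      using semiflow_add[OF sf, of "c (q n)" "s (r (q n + N))" w] c[of "q n"] s0(1)
      by (simp add: c_def)
    moreover have "(\<lambda>n. \<phi> (b (r (q n + N))) w) \<longlonglongrightarrow> v"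
      by (rule filterlim_compose[OF b_lim filterlim_compose[OF filterlim_subseq[OF r] qN]])
    ultimately have "\<phi> l y = v" using LIMSEQ_unique by force
    then have "\<phi> t y = v"
      using semiflow_add[OF sf, of "t - l" l y] l v(1) by (simp add: stationary_point_def)
    then show False using contra \<epsilon>(1) by simp
  qed
  then show thesis using that y_omega dist_y by blast
qed

lemma omega_limit_lyapunov_stable:
  fixes \<phi> :: "real \<Rightarrow> 'e::banach \<Rightarrow> 'e"
  assumes sf: "semiflow \<phi>" and "v \<in> omega_limit \<phi> w" "lyapunov_stable \<phi> v"
  shows "omega_limit \<phi> w = {v}"
proof -
  obtain s where s: "\<And>n. s n \<ge> real n" "(\<lambda>n. \<phi> (s n) w) \<longlonglongrightarrow> v"
    by (rule omega_limit_sequence[OF assms(2)]) blast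
  have le: "dist p v \<le> \<epsilon>" if p: "p \<in> omega_limit \<phi> w" and "\<epsilon> > 0" for p \<epsilon>
  proof -
    obtain d where d: "d > 0" "\<And>u t. norm (u - v) < d \<Longrightarrow> t \<ge> 0 \<Longrightarrow> norm (\<phi> t u - v) < \<epsilon>"
      using assms(3) \<open>\<epsilon> > 0\<close> unfolding lyapunov_stable_def by metis
    obtain n where "dist (\<phi> (s n) w) v < d"
      using tendstoD[OF s(2) d(1)] by (auto simp: eventually_sequentially)
    then have "dist v (\<phi> t w) \<le> \<epsilon>" if "t \<ge> s n" for t
      using d(2)[of "\<phi> (s n) w" "t - s n"] that s(1)[of n]
        semiflow_add[OF sf, of "t - s n" "s n" w]
      by (simp add: dist_norm norm_minus_commute)
    then have "omega_limit \<phi> w \<subseteq> cball v \<epsilon>"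
      using s(1)[of n] by (intro omega_limit_subset[where T = "s n"]) auto
    then show ?thesis using p by (auto simp: dist_commute)
  qed
  have "p = v" if "p \<in> omega_limit \<phi> w" for p
    using le[OF that, of "dist p v / 2"] by (cases "p = v") auto
  then show ?thesis using assms(2) by blast
qed

section \<open>The quadratic form\<close>

text \<open>
  Backward boundedness gives \<open>V(u\<^sub>1(t) - u\<^sub>2(t)) \<le> 0\<close> for all \<open>t\<close>. Strictness
  at \<open>t = 0\<close> comes from applying the squeezing inequality once more, on an interval of positive
  length ending at \<open>0\<close>: the continuous integrand does not vanish at the right end,
  because \<open>\<iota>\<close> is injective and \<open>p \<noteq> q\<close>.
\<close>

lemma squeezing_negative:
  fixes \<iota> :: "'e::banach \<Rightarrow> 'h::real_normed_vector"
    and P :: "'e \<Rightarrow>\<^sub>L ('e \<Rightarrow>\<^sub>L real)"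
  assumes emb: "continuous_embedding \<iota>" and sf: "semiflow \<phi>" and pos: "\<delta> > 0" "\<nu> > 0"
    and sq: "\<And>v\<^sub>1 v\<^sub>2 l r. 0 \<le> l \<Longrightarrow> l \<le> r \<Longrightarrow> r - l \<ge> \<tau> \<Longrightarrow>
           exp (2 * \<nu> * r) * quad_form P (\<phi> r v\<^sub>1 - \<phi> r v\<^sub>2)
           - exp (2 * \<nu> * l) * quad_form P (\<phi> l v\<^sub>1 - \<phi> l v\<^sub>2)
           \<le> - \<delta> * integral {l..r} (\<lambda>s. exp (2 * \<nu> * s) * (norm (\<iota> (\<phi> s v\<^sub>1 - \<phi> s v\<^sub>2)))\<^sup>2)"
    and u1: "complete_trajectory_through \<phi> p u\<^sub>1" "Bfun u\<^sub>1 at_bot"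
    and u2: "complete_trajectory_through \<phi> q u\<^sub>2" "Bfun u\<^sub>2 at_bot"
    and "p \<noteq> q"
  shows "quad_form P (p - q) < 0"
proof -
  have \<iota>: "bounded_linear \<iota>" "inj \<iota>" using emb by (auto simp: continuous_embedding_def)
  define I where "I r v\<^sub>1 v\<^sub>2 = integral {0..r} (\<lambda>s. exp (2 * \<nu> * s) * (norm (\<iota> (\<phi> s v\<^sub>1 - \<phi> s v\<^sub>2)))\<^sup>2)"
    for r v\<^sub>1 v\<^sub>2
  have cont: "continuous_on {0..r} (\<lambda>s. exp (2 * \<nu> * s) * (norm (\<iota> (\<phi> s v\<^sub>1 - \<phi> s v\<^sub>2)))\<^sup>2)" for r v\<^sub>1 v\<^sub>2
    by (intro continuous_intros bounded_linear.continuous_on[OF \<iota>(1)]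
        semiflow_continuous_on[OF sf]) auto
  have I_nonneg: "I r v\<^sub>1 v\<^sub>2 \<ge> 0" for r v\<^sub>1 v\<^sub>2
    unfolding I_def by (intro integral_nonneg integrable_continuous_real cont) auto
  have step: "exp (2 * \<nu> * r) * quad_form P (u\<^sub>1 t - u\<^sub>2 t)
      \<le> quad_form P (u\<^sub>1 (t - r) - u\<^sub>2 (t - r)) - \<delta> * I r (u\<^sub>1 (t - r)) (u\<^sub>2 (t - r))"
    if "r \<ge> 0" "r \<ge> \<tau>" for r t
  proof -
    have "\<phi> r (u\<^sub>1 (t - r)) = u\<^sub>1 t" "\<phi> r (u\<^sub>2 (t - r)) = u\<^sub>2 t"
      using u1(1) u2(1) that by (metis complete_trajectory_through_def add.commute diff_add_cancel)+
    then show ?thesis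
      using sq[of 0 r "u\<^sub>1 (t - r)" "u\<^sub>2 (t - r)"] that sf by (simp add: semiflow_zero I_def)
  qed
  \<comment> \<open>A positive value at \<open>t\<close> would force exponential growth of the form in backward time.\<close>
  have nonpos: "quad_form P (u\<^sub>1 t - u\<^sub>2 t) \<le> 0" for t
  proof (rule ccontr)
    assume neg: "\<not> ?thesis"
    obtain B1 B2 where B: "\<forall>\<^sub>F s in at_bot. norm (u\<^sub>1 s) \<le> B1" "\<forall>\<^sub>F s in at_bot. norm (u\<^sub>2 s) \<le> B2"
      using u1(2) u2(2) unfolding Bfun_def by blast
    define C where "C = norm P * (B1 + B2) * (B1 + B2)"
    have bd: "\<forall>\<^sub>F s in at_bot. quad_form P (u\<^sub>1 s - u\<^sub>2 s) \<le> C"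
      using B
    proof eventually_elim
      case (elim s)
      have n: "norm (u\<^sub>1 s - u\<^sub>2 s) \<le> B1 + B2"
        using norm_triangle_ineq4[of "u\<^sub>1 s" "u\<^sub>2 s"] elim by linarith
      have "quad_form P (u\<^sub>1 s - u\<^sub>2 s) \<le> norm (blinfun_apply P (u\<^sub>1 s - u\<^sub>2 s)) * norm (u\<^sub>1 s - u\<^sub>2 s)"
        unfolding quad_form_def pairing_def
        using norm_blinfun[of "blinfun_apply P (u\<^sub>1 s - u\<^sub>2 s)" "u\<^sub>1 s - u\<^sub>2 s"] by simp
      also have "\<dots> \<le> (norm P * norm (u\<^sub>1 s - u\<^sub>2 s)) * norm (u\<^sub>1 s - u\<^sub>2 s)"
        by (intro mult_right_mono norm_blinfun) auto
      also have "\<dots> \<le> C"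
        unfolding C_def using n order_trans[OF norm_ge_zero n] by (intro mult_mono) auto
      finally show ?case .
    qed
    then obtain s0 where s0: "\<And>s. s \<le> s0 \<Longrightarrow> quad_form P (u\<^sub>1 s - u\<^sub>2 s) \<le> C"
      by (auto simp: eventually_at_bot_linorder)
    define V where "V = quad_form P (u\<^sub>1 t - u\<^sub>2 t)"
    have V: "V > 0" using neg by (simp add: V_def)
    \<comment> \<open>So far back that the bound \<open>C\<close> applies and \<open>e\<^sup>2\<^sup>\<nu>\<^sup>r V \<ge> (1 + 2\<nu>r) V\<close> exceeds it.\<close>
    define r where "r = Max {0, \<tau>, t - s0, C / (2 * \<nu> * V)}"
    have r: "r \<ge> 0" "r \<ge> \<tau>" "r \<ge> t - s0" "r \<ge> C / (2 * \<nu> * V)" by (auto simp: r_def)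
    have "exp (2 * \<nu> * r) * V \<le> C"
      using step[OF r(1,2), of t] s0[of "t - r"] r(3) mult_nonneg_nonneg[OF less_imp_le[OF pos(1)] I_nonneg[of r "u\<^sub>1 (t - r)" "u\<^sub>2 (t - r)"]]
      by (simp add: V_def)
    moreover have "C \<le> 2 * \<nu> * r * V" using r(4) V pos by (simp add: field_simps)
    moreover have "(1 + 2 * \<nu> * r) * V \<le> exp (2 * \<nu> * r) * V"
      using V by (intro mult_right_mono exp_ge_add_one_self) auto
    ultimately show False using V by (simp add: distrib_right)
  qed
  \<comment> \<open>The squeezing inequality needs length at least \<open>\<tau>\<close>; the \<open>1\<close> makes the interval
    nondegenerate when \<open>\<tau> \<le> 0\<close>.\<close>
  define r where "r = max 1 \<tau>"
  have r: "r > 0" "r \<ge> \<tau>" by (auto simp: r_def)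
  have end_points: "\<phi> r (u\<^sub>1 (0 - r)) = p" "\<phi> r (u\<^sub>2 (0 - r)) = q"
    using u1(1) u2(1) r by (metis complete_trajectory_through_def add.commute diff_add_cancel less_imp_le)+
  have "I r (u\<^sub>1 (0 - r)) (u\<^sub>2 (0 - r)) \<noteq> 0"
  proof
    assume "I r (u\<^sub>1 (0 - r)) (u\<^sub>2 (0 - r)) = 0"
    then have "exp (2 * \<nu> * r) * (norm (\<iota> (\<phi> r (u\<^sub>1 (0 - r)) - \<phi> r (u\<^sub>2 (0 - r)))))\<^sup>2 = 0"
      using integral_eq_0_iff[OF cont[of r "u\<^sub>1 (0 - r)" "u\<^sub>2 (0 - r)"] r(1)] r(1) by (simp add: I_def)
    then have "\<iota> (p - q) = 0" using end_points by simp
    then show False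
      using \<iota> \<open>p \<noteq> q\<close> by (metis bounded_linear.linear injD linear_0 right_minus_eq)
  qed
  with I_nonneg[of r "u\<^sub>1 (0 - r)" "u\<^sub>2 (0 - r)"] pos(1)
  have "\<delta> * I r (u\<^sub>1 (0 - r)) (u\<^sub>2 (0 - r)) > 0" by simp
  with step[of r 0] nonpos[of "0 - r"] r
  have "exp (2 * \<nu> * r) * quad_form P (u\<^sub>1 0 - u\<^sub>2 0) < 0" by simp
  then show ?thesis using u1(1) u2(1) by (simp add: complete_trajectory_through_def mult_less_0_iff)
qed

text \<open>
  For \<open>v = a + b\<close> with \<open>a \<in> E\<^sup>+\<close>, \<open>b \<in> E\<^sup>-\<close> orthogonality gives \<open>V(a) = V(v - b) = V(v) + V(b)\<close>,
  so \<open>V(v) = V(a) - V(b) \<ge> 0\<close>.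
\<close>

lemma quad_form_nonneg_on_complement:
  fixes P :: "'e::real_normed_vector \<Rightarrow>\<^sub>L ('e \<Rightarrow>\<^sub>L real)"
  assumes sym: "symmetric_op P" and split: "direct_sum_splitting Ep Em"
    and pos: "positive_on P Ep" and neg: "negative_on P Em"
    and orth: "\<And>e. e \<in> Em \<Longrightarrow> pairing e (blinfun_apply P v) = 0"
  shows "quad_form P v \<ge> 0"
proof -
  obtain a b where ab: "a \<in> Ep" "b \<in> Em" "v = a + b"
    using split unfolding direct_sum_splitting_def by blast
  have "pairing b (blinfun_apply P v) = 0" "pairing v (blinfun_apply P b) = 0"
    using orth[OF ab(2)] sym by (auto simp: symmetric_op_def)
  moreover have "a = v - b" using ab by simp
  ultimately have "quad_form P a = quad_form P v + quad_form P b"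
    by (simp add: quad_form_def pairing_def blinfun.bilinear_simps)
  moreover have "quad_form P a \<ge> 0"
    using pos ab(1) by (cases "a = 0") (auto simp: positive_on_def quad_form_def pairing_def intro: less_imp_le)
  moreover have "quad_form P b \<le> 0"
    using neg ab(2) by (cases "b = 0") (auto simp: negative_on_def quad_form_def pairing_def intro: less_imp_le)
  ultimately show ?thesis by linarith
qed

text \<open>
  The projection onto \<open>E\<^sup>-\<close> along \<open>E\<^sup>+\<close> would also separate vectors on which \<open>V\<close> is negative, but it
  need not be continuous, as \<open>E\<^sup>+\<close> may fail to be closed. Pairing with a basis of \<open>E\<^sup>-\<close> through
  \<open>P\<close> amounts to the \<open>P\<close>-orthogonal projection, which is bounded.
\<close>

lemma negative_form_projection:
  fixes P :: "'e::real_normed_vector \<Rightarrow>\<^sub>L ('e \<Rightarrow>\<^sub>L real)"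
  assumes sym: "symmetric_op P" and split: "direct_sum_splitting Ep Em"
    and pos: "positive_on P Ep" and neg: "negative_on P Em" and dim: "dim Em = 2"
  obtains \<pi> :: "'e \<Rightarrow> real^2" where "bounded_linear \<pi>"
    "\<And>v. quad_form P v < 0 \<Longrightarrow> \<pi> v \<noteq> 0"
proof -
  obtain B where B: "B \<subseteq> Em" "Em \<subseteq> span B" "card B = 2"
    using basis_exists[of Em] dim by metis
  then obtain e1 e2 where e: "B = {e1, e2}" by (auto simp: card_2_iff)
  define \<pi> :: "'e \<Rightarrow> real^2"
    where "\<pi> v = pairing e1 (blinfun_apply P v) *\<^sub>R axis 1 1 + pairing e2 (blinfun_apply P v) *\<^sub>R axis 2 1" for v
  have lin: "bounded_linear (\<lambda>v. pairing e (blinfun_apply P v))" for e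
    unfolding pairing_def
    by (rule bounded_linear_compose[OF blinfun.bounded_linear_left blinfun.bounded_linear_right])
  have "bounded_linear \<pi>"
    unfolding \<pi>_def
    by (intro bounded_linear_add bounded_linear_compose[OF bounded_linear_scaleR_left lin])
  moreover have "\<pi> v \<noteq> 0" if v: "quad_form P v < 0" for v
  proof
    assume "\<pi> v = 0"
    then have "\<pi> v $ 1 = 0" "\<pi> v $ 2 = 0" by simp_all
    then have "pairing e1 (blinfun_apply P v) = 0" "pairing e2 (blinfun_apply P v) = 0"
      by (simp_all add: \<pi>_def axis_def)
    then have "pairing e (blinfun_apply P v) = 0" if "e \<in> Em" for e
      using that B(2) unfolding e span_insert
      by (auto simp: pairing_def blinfun.bilinear_simps subset_iff span_singleton algebra_simps)
    then show False
      using quad_form_nonneg_on_complement[OF sym split pos neg] v by force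
  qed
  ultimately show thesis using that by blast
qed

section \<open>Limit sets containing a point with an unstable set\<close>

text \<open>
  By invariance of domain \<open>\<pi>(D)\<close> is open, so a point of \<open>M\<close> near \<open>v\<close> has the same image as some
  point of \<open>D\<close> and is therefore equal to it.
\<close>

lemma homeomorphic_injective_image_absorbs:
  fixes \<pi> :: "'e::metric_space \<Rightarrow> 'a::euclidean_space" and S :: "'a set"
  assumes "open S" "S homeomorphic D" "continuous_on UNIV \<pi>" "inj_on \<pi> (D \<union> M)" "v \<in> D"
  obtains \<epsilon> where "\<epsilon> > 0" "M \<inter> cball v \<epsilon> \<subseteq> D"
proof -
  obtain h where h: "continuous_on S h" "inj_on h S" "h ` S = D"
    using assms(2) unfolding homeomorphic_def homeomorphism_def by (metis inj_on_inverseI)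
  have "open ((\<pi> \<circ> h) ` S)"
  proof (rule invariance_of_domain[OF _ assms(1)])
    show "continuous_on S (\<pi> \<circ> h)"
      using h(1) assms(3) by (intro continuous_on_compose) (auto intro: continuous_on_subset)
    show "inj_on (\<pi> \<circ> h) S"
      using h assms(4) by (intro comp_inj_on) (auto intro: inj_on_subset)
  qed
  then have "open (\<pi> ` D)" using h(3) by (metis image_comp)
  then have "open (\<pi> -` \<pi> ` D)" using assms(3) by (simp add: open_vimage)
  then obtain \<epsilon> where "\<epsilon> > 0" and \<epsilon>: "cball v \<epsilon> \<subseteq> \<pi> -` \<pi> ` D"
    using assms(5) open_contains_cball by (metis imageI vimageI)
  have "M \<inter> cball v \<epsilon> \<subseteq> D"
  proof
    fix p assume p: "p \<in> M \<inter> cball v \<epsilon>"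
    then obtain d where "d \<in> D" "\<pi> p = \<pi> d" using \<epsilon> by auto
    then show "p \<in> D" using assms(4) p by (metis IntD1 UnI1 UnI2 inj_onD)
  qed
  then show thesis using that \<open>\<epsilon> > 0\<close> by blast
qed

text \<open>
  Trapped in a compact part of \<open>D\<close>, the orbit of \<open>y\<close> has to accumulate at \<open>v\<close>, because the complete
  trajectories in \<open>\<omega>(y)\<close> emanate from \<open>v\<close>. From a point of the orbit very close to \<open>v\<close> the
  trajectory leads back to \<open>y\<close>, which backward stability keeps closer to \<open>v\<close> than it is unless
  \<open>y = v\<close>.
\<close>

lemma orbit_not_trapped_in_unstable_set:
  fixes \<phi> :: "real \<Rightarrow> 'e::banach \<Rightarrow> 'e" and v :: 'e
  assumes sf: "semiflow \<phi>" and D: "unstable_set TYPE('k::finite) \<phi> v D"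
    and K: "compact K" "K \<subseteq> D" "\<And>t. t \<ge> 0 \<Longrightarrow> \<phi> t y \<in> K"
    and u: "complete_trajectory_through \<phi> y u"
  shows "y = v"
proof (rule ccontr)
  assume "y \<noteq> v"
  have conv: "(x \<longlongrightarrow> v) at_bot" if "q \<in> D" "complete_trajectory_through \<phi> q x" for q x
    using D that unfolding unstable_set_def by blast
  obtain q where q: "q \<in> omega_limit \<phi> y"
    using omega_limit_nonempty[where T = 0 and \<phi> = \<phi> and w = y, OF K(1,3)] by blast
  obtain x where x: "complete_trajectory_through \<phi> q x" "range x \<subseteq> omega_limit \<phi> y"
    by (rule omega_limit_complete_trajectory[where T = 0 and w = y, OF sf K(1,3) q]) blast+
  have "q \<in> D"
    using q omega_limit_subset[where \<phi> = \<phi> and w = y, OF compact_imp_closed[OF K(1)] order_refl K(3)] K(2) by blast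
  \<comment> \<open>The backward limit of the trajectory through \<open>q\<close> lies in the closed invariant set
    \<open>\<omega>(y)\<close>.\<close>
  have "v \<in> omega_limit \<phi> y"
    by (rule Lim_in_closed_set[OF closed_omega_limit _ _ conv[OF \<open>q \<in> D\<close> x(1)]])
       (use x(2) in \<open>auto intro!: always_eventually\<close>)
  then obtain s where s: "\<And>n. s n \<ge> real n" "(\<lambda>n. \<phi> (s n) y) \<longlonglongrightarrow> v"
    by (rule omega_limit_sequence) blast
  have "\<forall>\<epsilon>>0. \<exists>d>0. \<forall>p\<in>D. norm (p - v) < d \<longrightarrow>
      (\<forall>x. complete_trajectory_through \<phi> p x \<longrightarrow> (\<forall>t\<le>0. norm (x t - v) < \<epsilon>))"
    using D unfolding unstable_set_def by (elim conjE)
  moreover have "dist y v > 0" using \<open>y \<noteq> v\<close> by simp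
  ultimately obtain d where d: "d > 0" "\<forall>p\<in>D. norm (p - v) < d \<longrightarrow>
      (\<forall>x. complete_trajectory_through \<phi> p x \<longrightarrow> (\<forall>t\<le>0. norm (x t - v) < dist y v))"
    by blast
  obtain n where n: "dist (\<phi> (s n) y) v < d"
    using tendstoD[OF s(2) d(1)] by (auto simp: eventually_sequentially)
  have s0: "s n \<ge> 0" using s(1)[of n] by simp
  have "u (s n) = \<phi> (s n) y" "u 0 = y"
    using u s0 unfolding complete_trajectory_through_def by (metis add.right_neutral)+
  moreover have "norm (u (- s n + s n) - v) < dist y v"
    by (rule d(2)[rule_format, OF _ _ shift_complete_trajectory[OF u]])
       (use calculation n K s0 in \<open>auto simp: dist_norm\<close>)
  ultimately show False by (simp add: dist_norm)
qed

text \<open>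
  The dimension of the unstable set enters only through invariance of domain: it has to agree
  with that of the space into which the backward bounded trajectories are projected injectively.
\<close>

lemma omega_limit_unstable_set:
  fixes \<phi> :: "real \<Rightarrow> 'e::banach \<Rightarrow> 'e" and v :: 'e
    and \<pi> :: "'e \<Rightarrow> real^'k"
  assumes sf: "semiflow \<phi>" and K: "compact K" "\<And>t. t \<ge> T \<Longrightarrow> \<phi> t w \<in> K"
    and v: "stationary_point \<phi> v" "v \<in> omega_limit \<phi> w"
    and D: "unstable_set TYPE('k::finite) \<phi> v D"
    and \<pi>: "continuous_on UNIV \<pi>"
      "\<And>p q u\<^sub>1 u\<^sub>2. \<lbrakk>complete_trajectory_through \<phi> p u\<^sub>1; Bfun u\<^sub>1 at_bot;
         complete_trajectory_through \<phi> q u\<^sub>2; Bfun u\<^sub>2 at_bot; \<pi> p = \<pi> q\<rbrakk> \<Longrightarrow> p = q"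
  shows "omega_limit \<phi> w = {v}"
proof (rule ccontr)
  assume "omega_limit \<phi> w \<noteq> {v}"
  then obtain p where p: "p \<in> omega_limit \<phi> w" "p \<noteq> v" using v(2) by blast
  have sub: "omega_limit \<phi> w \<subseteq> K"
    by (rule omega_limit_subset[where T = "max 0 T"]) (use K compact_imp_closed in auto)
  have traj: "\<exists>u. complete_trajectory_through \<phi> q u \<and> Bfun u at_bot"
    if q: "q \<in> D \<union> omega_limit \<phi> w" for q
  proof (cases "q \<in> D")
    case True
    then obtain u where u: "complete_trajectory_through \<phi> q u" "(u \<longlongrightarrow> v) at_bot"
      using D unfolding unstable_set_def by blast
    have "\<forall>\<^sub>F t in at_bot. norm (u t) \<le> norm v + 1"
      using order_tendstoD(2)[OF tendsto_norm[OF u(2)], of "norm v + 1"]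
      by (auto elim: eventually_mono)
    then show ?thesis using u(1) by (blast intro: BfunI)
  next
    case False
    obtain u where u: "complete_trajectory_through \<phi> q u" "range u \<subseteq> omega_limit \<phi> w"
      by (rule omega_limit_complete_trajectory[OF sf K, where p = q]) (use q False in blast)+
    obtain C where "\<And>x. x \<in> K \<Longrightarrow> norm x \<le> C"
      using compact_imp_bounded[OF K(1)] by (auto simp: bounded_iff)
    then have "Bfun u at_bot" using u(2) sub by (intro BfunI[of _ C] always_eventually) auto
    then show ?thesis using u(1) by blast
  qed
  have inj: "inj_on \<pi> (D \<union> omega_limit \<phi> w)"
    by (rule inj_onI) (use traj \<pi>(2) in metis)
  define S where "S = {x :: real^'k. \<forall>i. 0 < x $ i \<and> x $ i < 1}"
  have "S = box (\<chi> i. 0) (\<chi> i. 1)" by (auto simp: S_def mem_box_cart)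
  then have "open S" by (simp add: open_box)
  moreover have "S homeomorphic D" "v \<in> D" using D by (auto simp: unstable_set_def S_def)
  ultimately obtain \<epsilon>\<^sub>0 where \<epsilon>\<^sub>0: "\<epsilon>\<^sub>0 > 0" "omega_limit \<phi> w \<inter> cball v \<epsilon>\<^sub>0 \<subseteq> D"
    using homeomorphic_injective_image_absorbs \<pi>(1) inj by metis
  define \<epsilon> where "\<epsilon> = min \<epsilon>\<^sub>0 (dist p v / 2)"
  have \<epsilon>: "0 < \<epsilon>" "\<epsilon> < dist p v" "\<epsilon> \<le> \<epsilon>\<^sub>0"
    using \<epsilon>\<^sub>0(1) p(2) by (auto simp: \<epsilon>_def min_less_iff_disj)
  obtain y where y: "y \<in> omega_limit \<phi> w" "dist y v = \<epsilon>" "\<And>t. t \<ge> 0 \<Longrightarrow> dist (\<phi> t y) v \<le> \<epsilon>"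
    using omega_limit_incoming_point[OF sf K v p(1) \<epsilon>(1,2)] by metis
  obtain u where u: "complete_trajectory_through \<phi> y u"
    using omega_limit_complete_trajectory[OF sf K y(1)] by metis
  have "compact (omega_limit \<phi> w \<inter> cball v \<epsilon>)"
    using compact_Int_closed[OF K(1), of "omega_limit \<phi> w \<inter> cball v \<epsilon>"] sub
      closed_Int[OF closed_omega_limit closed_cball] by (metis inf.absorb_iff2 inf.assoc)
  moreover have "omega_limit \<phi> w \<inter> cball v \<epsilon> \<subseteq> D"
    using \<epsilon>\<^sub>0(2) \<epsilon>(3) by (auto simp: subset_iff)
  moreover have "\<phi> t y \<in> omega_limit \<phi> w \<inter> cball v \<epsilon>" if "t \<ge> 0" for t
    using omega_limit_forward_invariant[OF sf y(1) that] y(3)[OF that] by (simp add: dist_commute)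
  ultimately have "y = v" using orbit_not_trapped_in_unstable_set[OF sf D _ _ _ u] by metis
  then show False using y(2) \<epsilon>(1) by simp
qed

lemma bounded_semiorbit_eventually_in_compact:
  assumes sf: "semiflow \<phi>" and "\<tau> \<ge> 0" "compact_map (\<phi> \<tau>)" "bounded (positive_semiorbit \<phi> w)"
  obtains K where "compact K" "\<And>t. t \<ge> \<tau> \<Longrightarrow> \<phi> t w \<in> K"
proof
  show "compact (closure (\<phi> \<tau> ` positive_semiorbit \<phi> w))"
    using assms(3,4) by (simp add: compact_map_def)
  show "\<phi> t w \<in> closure (\<phi> \<tau> ` positive_semiorbit \<phi> w)" if "t \<ge> \<tau>" for t
  proof -
    have "\<phi> t w = \<phi> \<tau> (\<phi> (t - \<tau>) w)"
      using semiflow_add[OF sf assms(2), of "t - \<tau>" w] that by simp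
    then have "\<phi> t w \<in> \<phi> \<tau> ` positive_semiorbit \<phi> w"
      using that by (auto simp: positive_semiorbit_def)
    then show ?thesis by (rule subsetD[OF closure_subset])
  qed
qed

theorem corollary1p3:
  fixes \<iota> :: "'e::banach \<Rightarrow> 'h::{real_inner, complete_space}"
    and \<phi> :: "real \<Rightarrow> 'e \<Rightarrow> 'e"
    and P :: "'e \<Rightarrow>\<^sub>L ('e \<Rightarrow>\<^sub>L real)"
    and Ep Em :: "'e set"
    and \<delta> \<tau>\<^sub>V \<nu> \<tau>\<^sub>c\<^sub>o\<^sub>m \<tau>\<^sub>S C\<^sub>S :: real
    and w\<^sub>0 v\<^sub>0 :: 'e
  assumes "continuous_embedding \<iota>"
    and "semiflow \<phi>"
    and "symmetric_op P"
    and "direct_sum_splitting Ep Em"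
    and "positive_on P Ep"
    and "negative_on P Em"
    and "dim Em = 2"
    and "\<delta> > 0" and "\<tau>\<^sub>V \<ge> 0" and "\<nu> > 0"
    and "\<And>v\<^sub>1 v\<^sub>2 l r. 0 \<le> l \<Longrightarrow> l \<le> r \<Longrightarrow> r - l \<ge> \<tau>\<^sub>V \<Longrightarrow>
           exp (2 * \<nu> * r) * quad_form P (\<phi> r v\<^sub>1 - \<phi> r v\<^sub>2)
           - exp (2 * \<nu> * l) * quad_form P (\<phi> l v\<^sub>1 - \<phi> l v\<^sub>2)
           \<le> - \<delta> * integral {l..r} (\<lambda>s. exp (2 * \<nu> * s) * (norm (\<iota> (\<phi> s v\<^sub>1 - \<phi> s v\<^sub>2)))\<^sup>2)"
    and "\<tau>\<^sub>c\<^sub>o\<^sub>m > 0" and "compact_map (\<phi> \<tau>\<^sub>c\<^sub>o\<^sub>m)"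
    and "\<tau>\<^sub>S \<ge> 0" and "C\<^sub>S > 0"
    and "\<And>v\<^sub>1 v\<^sub>2. norm (\<phi> \<tau>\<^sub>S v\<^sub>1 - \<phi> \<tau>\<^sub>S v\<^sub>2) \<le> C\<^sub>S * norm (\<iota> (v\<^sub>1 - v\<^sub>2))"
    and "bounded (positive_semiorbit \<phi> w\<^sub>0)"
    and "v\<^sub>0 \<in> omega_limit \<phi> w\<^sub>0"
    and "terminal_point \<phi> v\<^sub>0"
  shows "omega_limit \<phi> w\<^sub>0 = {v\<^sub>0}"
proof -
  note emb = assms(1) and sf = assms(2) and splitting = assms(3-7)
    and squeeze = assms(11) and v0 = assms(18)
  have stat: "stationary_point \<phi> v\<^sub>0" using assms(19) by (simp add: terminal_point_def)
  obtain K where K: "compact K" "\<And>t. t \<ge> \<tau>\<^sub>c\<^sub>o\<^sub>m \<Longrightarrow> \<phi> t w\<^sub>0 \<in> K"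
    using bounded_semiorbit_eventually_in_compact[OF sf _ assms(13,17)] assms(12) by (metis less_imp_le)
  consider (stable) "lyapunov_stable \<phi> v\<^sub>0" | (unstable) D where "unstable_set TYPE(2) \<phi> v\<^sub>0 D"
    using assms(19) unfolding terminal_point_def by blast
  then show ?thesis
  proof cases
    case stable
    then show ?thesis using omega_limit_lyapunov_stable[OF sf v0] by blast
  next
    case unstable
    obtain \<pi> :: "'e \<Rightarrow> real^2" where \<pi>: "bounded_linear \<pi>"
      "\<And>v. quad_form P v < 0 \<Longrightarrow> \<pi> v \<noteq> 0"
      using negative_form_projection[OF splitting] by metis
    show ?thesis
    proof (rule omega_limit_unstable_set[OF sf K stat v0 unstable])
      show "continuous_on UNIV \<pi>" by (rule linear_continuous_on[OF \<pi>(1)])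
      fix p q u\<^sub>1 u\<^sub>2
      assume u: "complete_trajectory_through \<phi> p u\<^sub>1" "Bfun u\<^sub>1 at_bot"
        "complete_trajectory_through \<phi> q u\<^sub>2" "Bfun u\<^sub>2 at_bot" and eq: "\<pi> p = \<pi> q"
      show "p = q"
      proof (rule ccontr)
        assume "p \<noteq> q"
        from squeezing_negative[OF emb sf assms(8,10) squeeze u this]
        have "quad_form P (p - q) < 0" .
        from \<pi>(2)[OF this] eq show False
          by (simp add: linear_diff[OF bounded_linear.linear[OF \<pi>(1)]])
      qed
    qed
  qed
qed

end
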